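(* For every integer $n\ge 2$ there exists a real number $\varepsilon=\varepsilon(n)>0$ such that the vertex set of every $n$-vertex simplex all of whose side lengths belong to the interval $[1-\varepsilon,1+\varepsilon]$ is diameter-Ramsey.
   Context: An $n$-vertex simplex is a set of $n$ affinely independent points in some Euclidean space; its side lengths are the $\binom n2$ pairwise distances. For a finite set $X$, $\mathrm{diam}(X)$ denotes the largest Euclidean distance between two points of $X$. Two point sets are congruent if there is an isometry mapping one onto the other. A finite set $P$ of points in a Euclidean space is called diameter-Ramsey if for every integer $r\ge 2$ there exist an integer $d=d(P,r)$ and a finite set $R\subset\mathbb{R}^d$ with $\mathrm{diam}(R)=\mathrm{diam}(P)$ such that for every coloring of the points of $R$ with $r$ colors there is a monochromatic subset of $R$ congruent to $P$. *)

theory Defs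
  imports "HOL-Analysis.Analysis"
begin

text \<open>
  The dimensions of the spaces involved are quantified inside the statement, so \<open>\<real>\<^sup>d\<close> is the carrier
  \<^term>\<open>topspace (Euclidean_space d)\<close> of functions \<^typ>\<open>nat \<Rightarrow> real\<close> vanishing at all indices
  \<open>i \<ge> d\<close>. The type class \<^const>\<open>dist\<close> on \<^typ>\<open>nat \<Rightarrow> real\<close> metrizes the product topology
  and is not the Euclidean distance, hence the separate notions below.
\<close>

abbreviation Rn :: "nat \<Rightarrow> (nat \<Rightarrow> real) set"
  where "Rn d \<equiv> topspace (Euclidean_space d)"

definition edist :: "nat \<Rightarrow> (nat \<Rightarrow> real) \<Rightarrow> (nat \<Rightarrow> real) \<Rightarrow> real"
  where "edist d x y = L2_set (\<lambda>i. x i - y i) {..<d}"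

text \<open>Used for finite sets only.\<close>

definition ediam :: "nat \<Rightarrow> (nat \<Rightarrow> real) set \<Rightarrow> real"
  where "ediam d X = (if X = {} then 0 else Max {edist d x y | x y. x \<in> X \<and> y \<in> X})"

definition affinely_independent :: "nat \<Rightarrow> (nat \<Rightarrow> real) set \<Rightarrow> bool"
  where "affinely_independent d P \<longleftrightarrow>
    (\<forall>c :: (nat \<Rightarrow> real) \<Rightarrow> real.
       (\<Sum>p\<in>P. c p) = 0 \<and> (\<forall>i<d. (\<Sum>p\<in>P. c p * p i) = 0) \<longrightarrow> (\<forall>p\<in>P. c p = 0))"

definition simplex_vertices :: "nat \<Rightarrow> nat \<Rightarrow> (nat \<Rightarrow> real) set \<Rightarrow> bool"
  where "simplex_vertices n d P \<longleftrightarrow>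
    P \<subseteq> Rn d \<and> finite P \<and> card P = n \<and> affinely_independent d P"

text \<open>The two sets may lie in spaces of different dimensions \<open>d\<close> and \<open>e\<close>.\<close>

definition congruent_sets ::
    "nat \<Rightarrow> (nat \<Rightarrow> real) set \<Rightarrow> nat \<Rightarrow> (nat \<Rightarrow> real) set \<Rightarrow> bool"
  where "congruent_sets d P e Q \<longleftrightarrow>
    (\<exists>f. bij_betw f P Q \<and> (\<forall>x\<in>P. \<forall>y\<in>P. edist e (f x) (f y) = edist d x y))"

definition diameter_Ramsey :: "nat \<Rightarrow> (nat \<Rightarrow> real) set \<Rightarrow> bool"
  where "diameter_Ramsey m P \<longleftrightarrow>
    finite P \<and> P \<subseteq> Rn m \<and>
    (\<forall>r\<ge>2. \<exists>d R. finite R \<and> R \<subseteq> Rn d \<and> ediam d R = ediam m P \<and>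
       (\<forall>col :: (nat \<Rightarrow> real) \<Rightarrow> nat. col ` R \<subseteq> {..<r} \<longrightarrow>
          (\<exists>Q\<subseteq>R. congruent_sets m P d Q \<and> (\<exists>k<r. \<forall>q\<in>Q. col q = k))))"

end

theory Submission
  imports Defs "HOL-Library.Ramsey"
begin

text \<open>
  Spread a fixed nonnegative vector \<open>c\<close> of length \<open>k\<close>, in order, along the elements of a
  \<open>k\<close>-subset of \<open>{..<N}\<close>. Any two of the resulting points of \<open>\<real>\<^sup>N\<close> have a nonnegative inner product,
  so their distance is at most \<open>\<surd>2 \<bar>c\<bar>\<close>, which we make equal to the diameter \<open>D\<close> of the simplex.
  It remains to realise the simplex by such points with inner products
  \<open>g\<^sub>i\<^sub>j = (D\<^sup>2 - d\<^sub>i\<^sub>j\<^sup>2) / 2 \<ge> 0\<close>: reserve one entry of \<open>c\<close> for each pair \<open>(i, j)\<close> and let exactly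
  the \<open>i\<close>-th and the \<open>j\<close>-th subset agree at that entry. If all sides are nearly equal, then the
  \<open>g\<^sub>i\<^sub>j\<close> are small and one further entry of \<open>c\<close> brings the norm up to \<open>D / \<surd>2\<close>. Ramsey's theorem
  for \<open>k\<close>-subsets makes such a configuration monochromatic.
\<close>

section \<open>Ramsey's theorem for increasing lists\<close>

text \<open>Lists encode the \<open>k\<close>-subsets of \<open>{..<N}\<close>: the
  \<open>s\<close>-th smallest element is \<open>l ! s\<close>, and order-preserving relabelling is
  \<open>map\<close>.\<close>

definition increasing_lists :: "nat \<Rightarrow> nat \<Rightarrow> nat list set"
  where "increasing_lists N k = {l. length l = k \<and> sorted_wrt (<) l \<and> set l \<subseteq> {..<N}}"

lemma finite_increasing_lists: "finite (increasing_lists N k)"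
  by (rule finite_subset[OF _ finite_lists_length_eq[of "{..<N}" k]])
    (auto simp: increasing_lists_def)

lemma nth_increasing_lists:
  assumes "l \<in> increasing_lists N k" "s < length l"
  shows "l ! s < N"
  using assms nth_mem[of s l] by (auto simp: increasing_lists_def simp del: nth_mem)

lemma map_increasing_lists:
  assumes "strict_mono_on {..<M} u" "u ` {..<M} \<subseteq> {..<N}" "l \<in> increasing_lists M k"
  shows "map u l \<in> increasing_lists N k"
proof -
  have "sorted_wrt (\<lambda>x y. u x < u y) l"
  proof (rule sorted_wrt_mono_rel)
    show "sorted_wrt (<) l"
      using assms(3) by (simp add: increasing_lists_def)
    show "u x < u y" if "x \<in> set l" "y \<in> set l" "x < y" for x y
      using strict_mono_onD[OF assms(1)] that assms(3) by (auto simp: increasing_lists_def)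
  qed
  then show ?thesis
    using assms(2,3) by (fastforce simp: increasing_lists_def sorted_wrt_map)
qed

text \<open>Every configuration of lists over \<open>{..<M}\<close> can be moved into one colour
  class: \<open>u\<close> is the increasing enumeration of a homogeneous set of size
  \<open>M\<close>.\<close>

lemma ramsey_increasing_lists:
  fixes k M r :: nat
  obtains N where "\<And>col :: nat list \<Rightarrow> nat. col ` increasing_lists N k \<subseteq> {..<r} \<Longrightarrow>
    \<exists>u j. strict_mono_on {..<M} u \<and> u ` {..<M} \<subseteq> {..<N} \<and> j < r \<and>
      (\<forall>l\<in>increasing_lists M k. col (map u l) = j)"
proof -
  obtain N :: nat where N: "partn_lst {..<N} (replicate r M) k"
    using ramsey_full[of "replicate r M" k] by blast
  show ?thesis
  proof (rule that)
    fix col :: "nat list \<Rightarrow> nat"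
    assume col: "col ` increasing_lists N k \<subseteq> {..<r}"
    \<comment> \<open>A set is coloured through its increasing enumeration, so
      \<open>f (set l) = col l\<close> for increasing \<open>l\<close>.\<close>
    define f where "f A = col (sorted_list_of_set A)" for A
    have "f \<in> nsets {..<N} k \<rightarrow> {..<length (replicate r M)}"
      using col by (auto simp: f_def nsets_def increasing_lists_def image_subset_iff)
    then obtain j where j: "j < r" "monochromatic {..<N} M k f j"
      using N unfolding partn_lst_def by fastforce
    then obtain H where H: "H \<in> nsets {..<N} M" "f ` nsets H k \<subseteq> {j}"
      unfolding monochromatic_def by auto
    define u where "u i = sorted_list_of_set H ! i" for i
    have fin: "finite H" "card H = M" and HN: "H \<subseteq> {..<N}"
      using H(1) by (auto simp: nsets_def)
    have mono: "strict_mono_on {..<M} u"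
      using sorted_wrt_nth_less[OF strict_sorted_list_of_set[of H]] fin
      by (auto simp: strict_mono_on_def u_def)
    have uH: "u i \<in> H" if "i < M" for i
      using that fin nth_mem[of i "sorted_list_of_set H"] by (simp add: u_def)
    have "col (map u l) = j" if l: "l \<in> increasing_lists M k" for l
    proof -
      have inc: "map u l \<in> increasing_lists N k"
        using map_increasing_lists[OF mono _ l] uH HN by blast
      then have srt: "sorted_wrt (<) (map u l)" "length (map u l) = k"
        by (auto simp: increasing_lists_def)
      have "set (map u l) \<subseteq> H"
        using uH l by (auto simp: increasing_lists_def)
      then have "set (map u l) \<in> nsets H k"
        using srt by (metis (mono_tags, lifting) List.finite_set distinct_card mem_Collect_eq
            nsets_def strict_sorted_iff)
      then have "f (set (map u l)) = j"
        using H(2) by blast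
      moreover have "sorted_list_of_set (set (map u l)) = map u l"
        using srt(1) by (metis sorted_list_of_set.idem_if_sorted_distinct strict_sorted_iff)
      ultimately show ?thesis
        by (simp add: f_def)
    qed
    then show "\<exists>u j. strict_mono_on {..<M} u \<and> u ` {..<M} \<subseteq> {..<N} \<and> j < r \<and>
      (\<forall>l\<in>increasing_lists M k. col (map u l) = j)"
      using mono uH HN j(1) by blast
  qed
qed

section \<open>Spreading a fixed vector along lists, and the resulting inner products\<close>

definition spread :: "(nat \<Rightarrow> real) \<Rightarrow> nat list \<Rightarrow> nat \<Rightarrow> real"
  where "spread c l v = (\<Sum>s<length l. if l ! s = v then c s else 0)"

text \<open>The inner product of two spread points, written without the ambient dimension: only
  coincidences between list entries matter, so injective relabelling preserves it.\<close>

definition overlap :: "(nat \<Rightarrow> real) \<Rightarrow> nat list \<Rightarrow> nat list \<Rightarrow> real"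
  where "overlap c l l' =
    (\<Sum>s<length l. \<Sum>t<length l'. if l ! s = l' ! t then c s * c t else 0)"

lemma spread_in_Rn:
  assumes "l \<in> increasing_lists N k"
  shows "spread c l \<in> Rn N"
  using nth_increasing_lists[OF assms]
  by (fastforce simp: topspace_Euclidean_space spread_def intro!: sum.neutral)

lemma sum_spread_mult_spread:
  assumes "l \<in> increasing_lists N k"
  shows "(\<Sum>v<N. spread c l v * spread c l' v) = overlap c l l'"
proof -
  have "(\<Sum>v<N. spread c l v * spread c l' v) =
      (\<Sum>v<N. \<Sum>s<length l. \<Sum>t<length l'.
        (if l ! s = v then c s else 0) * (if l' ! t = v then c t else 0))"
    by (simp add: spread_def sum_product)
  also have "\<dots> = (\<Sum>s<length l. \<Sum>v<N. \<Sum>t<length l'.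
        (if l ! s = v then c s else 0) * (if l' ! t = v then c t else 0))"
    by (rule sum.swap)
  also have "\<dots> = (\<Sum>s<length l. \<Sum>t<length l'. \<Sum>v<N.
        (if l ! s = v then c s else 0) * (if l' ! t = v then c t else 0))"
    by (intro sum.cong refl sum.swap)
  also have "\<dots> = overlap c l l'"
    unfolding overlap_def
  proof (intro sum.cong refl)
    fix s t assume s: "s \<in> {..<length l}"
    have "(\<Sum>v<N. (if l ! s = v then c s else 0) * (if l' ! t = v then c t else 0)) =
        (\<Sum>v<N. if l ! s = v then (if l ! s = l' ! t then c s * c t else 0) else 0)"
      by (intro sum.cong) auto
    also have "\<dots> = (if l ! s = l' ! t then c s * c t else 0)"
      using nth_increasing_lists[OF assms, of s] s by simp
    finally show "(\<Sum>v<N. (if l ! s = v then c s else 0) * (if l' ! t = v then c t else 0)) =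
      (if l ! s = l' ! t then c s * c t else 0)" .
  qed
  finally show ?thesis .
qed

lemma overlap_nonneg: "(\<And>s. 0 \<le> c s) \<Longrightarrow> 0 \<le> overlap c l l'"
  by (auto simp: overlap_def intro!: sum_nonneg)

text \<open>Entries of an increasing list are distinct, so only the pairs \<open>s = t\<close>
  survive. All spread points thus lie on one sphere.\<close>

lemma overlap_self:
  assumes "l \<in> increasing_lists N k"
  shows "overlap c l l = (\<Sum>s<k. (c s)\<^sup>2)"
proof -
  have l: "length l = k" "distinct l"
    using assms by (auto simp: increasing_lists_def strict_sorted_iff)
  have "overlap c l l = (\<Sum>s<k. \<Sum>t<k. if s = t then c s * c t else 0)"
    unfolding overlap_def l(1) using l by (intro sum.cong refl) (auto simp: nth_eq_iff_index_eq)
  then show ?thesis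
    by (simp add: power2_eq_square)
qed

lemma overlap_map:
  assumes "inj_on u {..<M}" "l \<in> increasing_lists M k" "l' \<in> increasing_lists M k'"
  shows "overlap c (map u l) (map u l') = overlap c l l'"
  unfolding overlap_def
  using inj_onD[OF assms(1)] nth_increasing_lists[OF assms(2)] nth_increasing_lists[OF assms(3)]
  by (intro sum.cong) auto

lemma edist_spread:
  assumes "l \<in> increasing_lists N k" "l' \<in> increasing_lists N k"
  shows "edist N (spread c l) (spread c l') =
    sqrt (2 * (\<Sum>s<k. (c s)\<^sup>2) - 2 * overlap c l l')"
proof -
  have "(\<Sum>v<N. (spread c l v - spread c l' v)\<^sup>2) =
      (\<Sum>v<N. spread c l v * spread c l v) + (\<Sum>v<N. spread c l' v * spread c l' v)
        - 2 * (\<Sum>v<N. spread c l v * spread c l' v)"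
    by (simp add: power2_eq_square algebra_simps sum.distrib sum_subtractf sum_distrib_left)
  also have "\<dots> = 2 * (\<Sum>s<k. (c s)\<^sup>2) - 2 * overlap c l l'"
    using assms by (simp add: sum_spread_mult_spread overlap_self)
  finally show ?thesis
    by (simp add: edist_def L2_set_def)
qed

section \<open>Realising prescribed inner products\<close>

text \<open>
  Entry \<open>s = a * n + b\<close> of \<open>c\<close> is reserved for the ordered pair \<open>(a, b)\<close> and is placed inside the
  block \<open>{s * n..<s * n + n}\<close>: the \<open>i\<close>-th list uses position \<open>i\<close> of the block, except that the
  \<open>b\<close>-th list uses position \<open>a\<close>. Both \<open>(i, j)\<close> and \<open>(j, i)\<close> contribute, which explains the
  factor \<open>1 / 2\<close>.
\<close>

lemma increasing_lists_with_overlaps: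
  fixes n :: nat and G :: "nat \<Rightarrow> nat \<Rightarrow> real"
  assumes G: "\<And>i j. i < n \<Longrightarrow> j < n \<Longrightarrow> 0 \<le> G i j \<and> G i j \<le> B"
    and sym: "\<And>i j. i < n \<Longrightarrow> j < n \<Longrightarrow> G i j = G j i"
    and small: "real (n * n) * B \<le> 2 * S"
  obtains k M c L where "\<And>s. 0 \<le> c s" "(\<Sum>s<k. (c s)\<^sup>2) = S"
    "\<And>i. i < n \<Longrightarrow> L i \<in> increasing_lists M k"
    "\<And>i j. i < n \<Longrightarrow> j < n \<Longrightarrow> i \<noteq> j \<Longrightarrow> overlap c (L i) (L j) = G i j"
proof -
  \<comment> \<open>One entry per ordered pair; the extra entry at index \<open>n * n\<close>
    carries the remaining squared norm \<open>S - T\<close>.\<close>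
  define k where "k = Suc (n * n)"
  define T where "T = (\<Sum>s<n * n. G (s div n) (s mod n) / 2)"
  define c where "c s = (if s < n * n then sqrt (G (s div n) (s mod n) / 2)
    else sqrt (S - T))" for s
  \<comment> \<open>The offset of list \<open>i\<close> inside block \<open>s\<close>. In the extra
    block and in the blocks of pairs \<open>(a, a)\<close> all offsets differ, so nothing is shared
    there.\<close>
  define f where "f s i = (if s < n * n \<and> i = s mod n then s div n else i)" for s i
  define L where "L i = map (\<lambda>s. s * n + f s i) [0..<k]" for i
  have divmod: "s div n < n" "s mod n < n" if "s < n * n" for s
    using that by (auto simp: less_mult_imp_div_less intro!: mod_less_divisor gr0I)
  have fn: "f s i < n" if "i < n" for s i
    using that divmod by (simp add: f_def)
  \<comment> \<open>Each of the \<open>n * n\<close> terms is at most \<open>B / 2\<close>, so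
    \<open>small\<close> makes \<open>S - T\<close> a legitimate square.\<close>
  have T: "T \<le> S"
  proof -
    have "T \<le> (\<Sum>s<n * n. B / 2)"
      unfolding T_def using G divmod by (intro sum_mono) auto
    then show ?thesis
      using small by simp
  qed
  have c0: "0 \<le> c s" for s
    using G divmod T by (simp add: c_def)
  have csq: "(c s)\<^sup>2 = G (s div n) (s mod n) / 2" if "s < n * n" for s
    using that G divmod by (simp add: c_def)
  have "(\<Sum>s<k. (c s)\<^sup>2) = T + (c (n * n))\<^sup>2"
    by (simp add: k_def T_def csq)
  also have "\<dots> = S"
    using T by (simp add: c_def)
  finally have csum: "(\<Sum>s<k. (c s)\<^sup>2) = S" .
  have block: "s * n + a < t * n + b" if "s < t" "a < n" for s t a b
  proof -
    have "s * n + a < Suc s * n"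
      using that by simp
    also have "\<dots> \<le> t * n"
      using that by (intro mult_le_mono1) simp
    finally show ?thesis by simp
  qed
  have L: "L i \<in> increasing_lists (k * n) k" if "i < n" for i
    using that fn block[of _ k _ 0]
    by (auto simp: increasing_lists_def L_def sorted_wrt_iff_nth_less intro!: block)
  \<comment> \<open>Blocks are disjoint, so two lists can coincide only at equal indices; this
    reduces the double sum in \<open>overlap\<close> to a single one.\<close>
  have same: "s * n + f s i = t * n + f t j \<longleftrightarrow> s = t \<and> f s i = f t j"
    if "i < n" "j < n" for s t i j
    using block[of s t "f s i" "f t j"] block[of t s "f t j" "f s i"] fn that
    by (metis add_left_cancel linorder_less_linear nat_neq_iff)
  have ov: "overlap c (L i) (L j) = G i j" if ij: "i < n" "j < n" "i \<noteq> j" for i j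
  proof -
    \<comment> \<open>If \<open>s\<close> encodes \<open>(a, b)\<close>, only offset
      \<open>b\<close> is moved, namely to \<open>a\<close>; so two distinct lists meet there
      exactly when they are the \<open>a\<close>-th and the \<open>b\<close>-th.\<close>
    have agree: "f s i = f s j \<longleftrightarrow> s = i * n + j \<or> s = j * n + i" if "s < k" for s
    proof (cases "s < n * n")
      case True
      have "s = a * n + b \<longleftrightarrow> s div n = a \<and> s mod n = b" if "b < n" for a b
        using that div_mult_mod_eq[of s n] by auto
      from this[of j i] this[of i j] show ?thesis
        using True ij by (auto simp: f_def)
    next
      case False
      then show ?thesis
        using ij block[of i n j 0] block[of j n i 0] by (auto simp: f_def)
    qed
    have bnd: "i * n + j < n * n" "j * n + i < n * n"
      using block[of i n j 0] block[of j n i 0] ij by auto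
    have ne: "i * n + j \<noteq> j * n + i"
      using block[of i j j i] block[of j i i j] ij by (metis nat_neq_iff)
    have "overlap c (L i) (L j) =
        (\<Sum>s<k. \<Sum>t<k. if s = t then (if f s i = f s j then c s * c s else 0) else 0)"
      unfolding overlap_def L_def using ij by (intro sum.cong) (auto simp: same)
    also have "\<dots> = (\<Sum>s<k. if f s i = f s j then c s * c s else 0)"
      by simp
    also have "\<dots> = (\<Sum>s<k. (if s = i * n + j then (c s)\<^sup>2 else 0) +
        (if s = j * n + i then (c s)\<^sup>2 else 0))"
      using ne by (intro sum.cong refl) (auto simp: agree power2_eq_square)
    also have "\<dots> = (c (i * n + j))\<^sup>2 + (c (j * n + i))\<^sup>2"
      using bnd by (simp add: sum.distrib k_def)
    also have "\<dots> = G i j"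
      using bnd ij sym[of i j] by (simp add: csq)
    finally show ?thesis .
  qed
  show ?thesis
    using that[OF c0 csum L ov] by blast
qed

section \<open>Diameters of finite sets\<close>

lemma finite_edist_set: "finite X \<Longrightarrow> finite {edist d x y | x y. x \<in> X \<and> y \<in> X}"
  by (rule finite_surj[of "X \<times> X" _ "\<lambda>(x, y). edist d x y"]) auto

lemma edist_le_ediam:
  assumes "finite X" "x \<in> X" "y \<in> X"
  shows "edist d x y \<le> ediam d X"
  using assms finite_edist_set[of X d] by (auto simp: ediam_def intro!: Max_ge)

lemma ediam_attained:
  assumes "finite X" "X \<noteq> {}"
  obtains x y where "x \<in> X" "y \<in> X" "edist d x y = ediam d X"
proof -
  have "Max {edist d x y | x y. x \<in> X \<and> y \<in> X} \<in> {edist d x y | x y. x \<in> X \<and> y \<in> X}"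
    using assms finite_edist_set[of X d] by (intro Max_in) auto
  then obtain x y where "x \<in> X" "y \<in> X" "Max {edist d x y | x y. x \<in> X \<and> y \<in> X} = edist d x y"
    by blast
  then show ?thesis
    using that[of x y] assms(2) by (simp add: ediam_def)
qed

lemma edist_commute: "edist d x y = edist d y x"
  by (simp add: edist_def L2_set_def power2_commute)

lemma edist_self [simp]: "edist d x x = 0"
  by (simp add: edist_def L2_set_def)

lemma edist_nonneg: "0 \<le> edist d x y"
  by (simp add: edist_def)

section \<open>From nearly equal distances to the diameter-Ramsey property\<close>

text \<open>With \<open>D\<close> the diameter and \<open>n = card P\<close>, \<open>near\<close>
  bounds each required inner product \<open>(D\<^sup>2 - d\<^sup>2) / 2\<close> by
  \<open>D\<^sup>2 / n\<^sup>2\<close>, so that all pair entries fit into the squared norm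
  \<open>D\<^sup>2 / 2\<close>.\<close>

lemma diameter_Ramsey_if_almost_regular:
  fixes P :: "(nat \<Rightarrow> real) set"
  assumes P: "finite P" "P \<subseteq> Rn m" "P \<noteq> {}"
    and pos: "\<And>x y. x \<in> P \<Longrightarrow> y \<in> P \<Longrightarrow> x \<noteq> y \<Longrightarrow> 0 < edist m x y"
    and near: "\<And>x y. x \<in> P \<Longrightarrow> y \<in> P \<Longrightarrow> x \<noteq> y \<Longrightarrow>
      ((ediam m P)\<^sup>2 - (edist m x y)\<^sup>2) * (real (card P))\<^sup>2 \<le> 2 * (ediam m P)\<^sup>2"
  shows "diameter_Ramsey m P"
proof -
  define n where "n = card P"
  define D where "D = ediam m P"
  obtain h where h: "bij_betw h {..<n} P"
    using ex_bij_betw_nat_finite[OF P(1)] by (auto simp: n_def atLeast0LessThan)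
  have n0: "0 < n"
    using P by (simp add: n_def card_gt_0_iff)
  have hP: "h i \<in> P" if "i < n" for i
    using h that by (auto simp: bij_betw_def)
  have h_eq: "h i = h j \<longleftrightarrow> i = j" if "i < n" "j < n" for i j
    using h that by (auto simp: bij_betw_def inj_on_def)
  have dD: "edist m x y \<le> D" if "x \<in> P" "y \<in> P" for x y
    using edist_le_ediam[OF P(1) that] by (simp add: D_def)
  have D0: "0 \<le> D"
    using dD[OF hP hP, OF n0 n0] by simp
  \<comment> \<open>The diagonal value \<open>0\<close> is a default satisfying the bounds; overlaps
    are prescribed only for \<open>i \<noteq> j\<close>.\<close>
  define G where "G i j = (if i = j then 0 else (D\<^sup>2 - (edist m (h i) (h j))\<^sup>2) / 2)" for i j
  define B where "B = D\<^sup>2 / (real n)\<^sup>2"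
  have G: "0 \<le> G i j \<and> G i j \<le> B" if "i < n" "j < n" for i j
  proof (cases "i = j")
    case False
    have "(edist m (h i) (h j))\<^sup>2 \<le> D\<^sup>2"
      using dD[OF hP hP, OF that] edist_nonneg by (intro power_mono)
    moreover have "(D\<^sup>2 - (edist m (h i) (h j))\<^sup>2) * (real n)\<^sup>2 \<le> 2 * D\<^sup>2"
      using near[OF hP hP, OF that] False that by (simp add: h_eq D_def n_def)
    ultimately show ?thesis
      using False n0 by (simp add: G_def B_def field_simps)
  qed (simp add: G_def B_def)
  have sym: "G i j = G j i" for i j
    by (simp add: G_def edist_commute)
  have small: "real (n * n) * B \<le> 2 * (D\<^sup>2 / 2)"
    using n0 by (simp add: B_def power2_eq_square)
  obtain k M c L where c0: "\<And>s. 0 \<le> c s" and csum: "(\<Sum>s<k. (c s)\<^sup>2) = D\<^sup>2 / 2"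
    and L: "\<And>i. i < n \<Longrightarrow> L i \<in> increasing_lists M k"
    and ov: "\<And>i j. i < n \<Longrightarrow> j < n \<Longrightarrow> i \<noteq> j \<Longrightarrow> overlap c (L i) (L j) = G i j"
    by (rule increasing_lists_with_overlaps[of n G B "D\<^sup>2 / 2", OF _ sym small])
      (use G in blast, rule that)
  have "\<exists>d R. finite R \<and> R \<subseteq> Rn d \<and> ediam d R = D \<and>
       (\<forall>col :: (nat \<Rightarrow> real) \<Rightarrow> nat. col ` R \<subseteq> {..<r} \<longrightarrow>
          (\<exists>Q\<subseteq>R. congruent_sets m P d Q \<and> (\<exists>k<r. \<forall>q\<in>Q. col q = k)))"
    if "2 \<le> r" for r
  proof -
    \<comment> \<open>The configuration \<open>L\<close> is fixed before \<open>r\<close>; only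
      \<open>N\<close> depends on the number of colours.\<close>
    obtain N where N: "\<And>col :: nat list \<Rightarrow> nat. col ` increasing_lists N k \<subseteq> {..<r} \<Longrightarrow>
      \<exists>u j. strict_mono_on {..<M} u \<and> u ` {..<M} \<subseteq> {..<N} \<and> j < r \<and>
        (\<forall>l\<in>increasing_lists M k. col (map u l) = j)"
      by (rule ramsey_increasing_lists[of k r M]) (rule that)
    define R where "R = spread c ` increasing_lists N k"
    have finR: "finite R"
      by (simp add: R_def finite_increasing_lists)
    have mono: "\<exists>Q\<subseteq>R. congruent_sets m P N Q \<and> (\<exists>k<r. \<forall>q\<in>Q. col q = k)"
      if col: "col ` R \<subseteq> {..<r}" for col :: "(nat \<Rightarrow> real) \<Rightarrow> nat"
    proof -
      have "(\<lambda>l. col (spread c l)) ` increasing_lists N k \<subseteq> {..<r}"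
        using col by (auto simp: R_def)
      from N[OF this] obtain u j where u: "strict_mono_on {..<M} u" "u ` {..<M} \<subseteq> {..<N}"
        and j: "j < r" "\<And>l. l \<in> increasing_lists M k \<Longrightarrow> col (spread c (map u l)) = j"
        by blast
      define q where "q i = spread c (map u (L i))" for i
      have uL: "map u (L i) \<in> increasing_lists N k" if "i < n" for i
        using map_increasing_lists[OF u L[OF that]] .
      have dist: "edist N (q i) (q j) = edist m (h i) (h j)" if ij: "i < n" "j < n" for i j
      proof (cases "i = j")
        case False
        have "D\<^sup>2 - 2 * G i j = (edist m (h i) (h j))\<^sup>2"
          using False by (simp add: G_def field_simps)
        moreover have "edist N (q i) (q j) = sqrt (D\<^sup>2 - 2 * G i j)"
          using edist_spread[OF uL uL, OF ij, of c] csum ov[OF ij False]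
            overlap_map[OF strict_mono_on_imp_inj_on[OF u(1)] L L, OF ij, of c]
          by (simp add: q_def)
        ultimately show ?thesis
          by (simp add: edist_nonneg)
      qed simp
      define g where "g = inv_into {..<n} h"
      have g: "g x < n" "h (g x) = x" if "x \<in> P" for x
        using h that by (auto simp: g_def bij_betw_def f_inv_into_f dest: inv_into_into)
      have dist': "edist N (q (g x)) (q (g y)) = edist m x y" if "x \<in> P" "y \<in> P" for x y
        using dist[of "g x" "g y"] g that by simp
      have "inj_on (\<lambda>x. q (g x)) P"
      proof (rule inj_onI, rule ccontr)
        fix x y assume xy: "x \<in> P" "y \<in> P" "q (g x) = q (g y)" "x \<noteq> y"
        then show False
          using dist'[of x y] pos[of x y] by simp
      qed
      then have "congruent_sets m P N ((\<lambda>x. q (g x)) ` P)"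
        unfolding congruent_sets_def bij_betw_def using dist' by blast
      moreover have "(\<lambda>x. q (g x)) ` P \<subseteq> R"
        using uL g by (auto simp: R_def q_def)
      moreover have "\<forall>y\<in>(\<lambda>x. q (g x)) ` P. col y = j"
        using j(2) L g by (auto simp: q_def)
      ultimately show ?thesis
        using j(1) by blast
    qed
    \<comment> \<open>A constant colouring already yields a copy of \<open>P\<close> inside
      \<open>R\<close>, so the diameter of \<open>R\<close> is at least \<open>D\<close>.\<close>
    have "(\<lambda>_. 0) ` R \<subseteq> {..<r}"
      using \<open>2 \<le> r\<close> by auto
    from mono[OF this] obtain Q where Q: "Q \<subseteq> R" "congruent_sets m P N Q"
      by blast
    then obtain f where f: "bij_betw f P Q"
      "\<And>x y. x \<in> P \<Longrightarrow> y \<in> P \<Longrightarrow> edist N (f x) (f y) = edist m x y"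
      unfolding congruent_sets_def by blast
    obtain x y where xy: "x \<in> P" "y \<in> P" "edist m x y = D"
      using ediam_attained[OF P(1,3)] D_def by metis
    have fR: "f x \<in> R" "f y \<in> R"
      using f(1) Q(1) xy by (auto simp: bij_betw_def)
    have "D \<le> ediam N R"
      using edist_le_ediam[OF finR fR, of N] f(2) xy by simp
    \<comment> \<open>Nonnegative entries give nonnegative overlaps, so no two points of
      \<open>R\<close> are farther apart than \<open>D\<close>.\<close>
    moreover have "ediam N R \<le> D"
    proof -
      obtain x y where "x \<in> R" "y \<in> R" and diam: "edist N x y = ediam N R"
        using ediam_attained[OF finR, of N] fR by blast
      then obtain l l' where l: "l \<in> increasing_lists N k" "l' \<in> increasing_lists N k"
        and "x = spread c l" "y = spread c l'"
        by (auto simp: R_def)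
      with diam have "edist N (spread c l) (spread c l') = ediam N R"
        by simp
      then have "ediam N R = sqrt (D\<^sup>2 - 2 * overlap c l l')"
        using edist_spread[OF l, of c] csum by simp
      also have "\<dots> \<le> sqrt (D\<^sup>2)"
        using overlap_nonneg[of c l l', OF c0] by (intro real_sqrt_le_mono) simp
      finally show ?thesis
        using D0 by simp
    qed
    ultimately have "ediam N R = D"
      by simp
    moreover have "R \<subseteq> Rn N"
      unfolding R_def using spread_in_Rn by blast
    ultimately show ?thesis
      using finR mono by blast
  qed
  then show ?thesis
    using P by (simp add: diameter_Ramsey_def D_def)
qed

section \<open>The choice of \<epsilon>\<close>

theorem theorem6:
  fixes n :: nat
  assumes "n \<ge> 2"
  shows "\<exists>\<epsilon>::real. \<epsilon> > 0 \<and>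
    (\<forall>m P. simplex_vertices n m P \<longrightarrow>
       (\<forall>x\<in>P. \<forall>y\<in>P. x \<noteq> y \<longrightarrow> edist m x y \<in> {1 - \<epsilon>..1 + \<epsilon>}) \<longrightarrow>
       diameter_Ramsey m P)"
proof (intro exI conjI allI impI)
  \<comment> \<open>Squared sides differ by at most \<open>(1 + \<epsilon>)\<^sup>2 - (1 -
    \<epsilon>)\<^sup>2 = 4 * \<epsilon>\<close>; times \<open>n\<^sup>2\<close> this is
    \<open>1\<close>, which is below \<open>2 * D\<^sup>2\<close> because \<open>n \<ge> 2\<close>
    forces \<open>D \<ge> 1 - \<epsilon> \<ge> 15 / 16\<close>.\<close>
  define \<epsilon> where "\<epsilon> = 1 / (4 * (real n)\<^sup>2)"
  show "\<epsilon> > 0"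
    using assms by (simp add: \<epsilon>_def)
  have n4: "4 \<le> (real n)\<^sup>2"
    using power_mono[of 2 "real n" 2] assms by simp
  then have e: "\<epsilon> * (real n)\<^sup>2 = 1 / 4" "\<epsilon> \<le> 1 / 16"
    using assms by (simp_all add: \<epsilon>_def divide_simps)
  fix m and P :: "(nat \<Rightarrow> real) set"
  assume "simplex_vertices n m P"
  then have P: "finite P" "P \<subseteq> Rn m" "card P = n"
    by (auto simp: simplex_vertices_def)
  then have ne: "P \<noteq> {}"
    using assms by auto
  assume "\<forall>x\<in>P. \<forall>y\<in>P. x \<noteq> y \<longrightarrow> edist m x y \<in> {1 - \<epsilon>..1 + \<epsilon>}"
  then have sides: "1 - \<epsilon> \<le> edist m x y" "edist m x y \<le> 1 + \<epsilon>"
    if "x \<in> P" "y \<in> P" "x \<noteq> y" for x y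
    using that by auto
  define D where "D = ediam m P"
  \<comment> \<open>The diameter is attained either at two distinct points, hence is a side, or at
    equal points, where it is \<open>0\<close>.\<close>
  have "D \<le> 1 + \<epsilon>"
    using ediam_attained[OF P(1) ne, of m] sides(2) \<open>\<epsilon> > 0\<close> unfolding D_def
    by (metis edist_self add_nonneg_nonneg less_eq_real_def zero_le_one)
  show "diameter_Ramsey m P"
  proof (rule diameter_Ramsey_if_almost_regular[OF P(1,2) ne])
    fix x y assume xy: "x \<in> P" "y \<in> P" "x \<noteq> y"
    show "0 < edist m x y"
      using sides(1)[OF xy] e by simp
    have lo: "1 - \<epsilon> \<le> D"
      using sides(1)[OF xy] edist_le_ediam[OF P(1) xy(1,2), of m] by (simp add: D_def)
    have "D\<^sup>2 \<le> (1 + \<epsilon>)\<^sup>2"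
      using \<open>D \<le> 1 + \<epsilon>\<close> lo e by (intro power_mono) auto
    moreover have "(1 - \<epsilon>)\<^sup>2 \<le> (edist m x y)\<^sup>2"
      using sides(1)[OF xy] e by (intro power_mono) auto
    ultimately have "D\<^sup>2 - (edist m x y)\<^sup>2 \<le> 4 * \<epsilon>"
      by (simp add: power2_eq_square algebra_simps)
    then have "(D\<^sup>2 - (edist m x y)\<^sup>2) * (real n)\<^sup>2 \<le> 4 * \<epsilon> * (real n)\<^sup>2"
      by (rule mult_right_mono) simp
    also have "\<dots> = 1"
      using e by simp
    also have "1 \<le> 2 * (15 / 16 :: real)\<^sup>2"
      by (simp add: power2_eq_square)
    also have "\<dots> \<le> 2 * D\<^sup>2"
      using lo e by (intro mult_left_mono power_mono) auto
    finally show "((ediam m P)\<^sup>2 - (edist m x y)\<^sup>2) * (real (card P))\<^sup>2 \<le> 2 * (ediam m P)\<^sup>2"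
      by (simp add: D_def P(3))
  qed
qed

end
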